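(* Let $a\in\mathbb{D}$ and let $\varphi_{a,1}(z)=\dfrac{a-z}{1-\overline{a}z}$ for $z\in\mathbb{D}$. The Berezin range $B(C_{\varphi_{a,1}})$ of the composition operator $C_{\varphi_{a,1}}$ on the Bergman space $A^2(\mathbb{D})$ is a convex subset of $\mathbb{C}$ if and only if $0\le |a|\le \frac{\sqrt{2}}{2}$.
   Context: $\mathbb{D}$ is the open unit disk in $\mathbb{C}$. $A^2(\mathbb{D})$ is the Bergman space of holomorphic functions $f:\mathbb{D}\to\mathbb{C}$ with $\int_{\mathbb{D}}|f|^2\,dV<\infty$ ($dV$ is the area measure), with the $L^2$ inner product. For a holomorphic self-map $\varphi$ of $\mathbb{D}$, $C_\varphi f=f\circ\varphi$. For $z\in\mathbb{D}$, $K_z\in A^2(\mathbb{D})$ is the reproducing (Bergman) kernel, i.e. $f(z)=\langle f,K_z\rangle$ for all $f\in A^2(\mathbb{D})$, and $k_z=K_z/\|K_z\|$ is the normalized kernel. The Berezin transform of a bounded operator $T$ on $A^2(\mathbb{D})$ is $\widetilde{T}(z)=\langle Tk_z,k_z\rangle$, and its Berezin range is $B(T)=\{\widetilde{T}(z): z\in\mathbb{D}\}\subset\mathbb{C}$. *)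

theory Defs
  imports "HOL-Complex_Analysis.Complex_Analysis"
begin

abbreviation unit_disk :: "complex set" where
  "unit_disk \<equiv> ball 0 1"

text \<open>
  A function on the disk is represented by its extension by \<open>0\<close> to the whole plane. Two
  representatives are then equal as soon as they agree on the disk, so that the reproducing
  kernel below is unique.
\<close>
definition bergman_space :: "(complex \<Rightarrow> complex) set" where
  "bergman_space = {f. f holomorphic_on unit_disk
     \<and> set_integrable lborel unit_disk (\<lambda>z. (cmod (f z))\<^sup>2)
     \<and> (\<forall>z. z \<notin> unit_disk \<longrightarrow> f z = 0)}"

definition bergman_inner :: "(complex \<Rightarrow> complex) \<Rightarrow> (complex \<Rightarrow> complex) \<Rightarrow> complex" where
  "bergman_inner f g = (LINT z:unit_disk|lborel. f z * cnj (g z))"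

definition bergman_norm :: "(complex \<Rightarrow> complex) \<Rightarrow> real" where
  "bergman_norm f = sqrt (Re (bergman_inner f f))"

definition bergman_kernel :: "complex \<Rightarrow> complex \<Rightarrow> complex" where
  "bergman_kernel z = (THE K. K \<in> bergman_space \<and> (\<forall>f\<in>bergman_space. f z = bergman_inner f K))"

definition normalized_bergman_kernel :: "complex \<Rightarrow> complex \<Rightarrow> complex" where
  "normalized_bergman_kernel z =
     (\<lambda>w. bergman_kernel z w / of_real (bergman_norm (bergman_kernel z)))"

definition composition_operator ::
    "(complex \<Rightarrow> complex) \<Rightarrow> (complex \<Rightarrow> complex) \<Rightarrow> complex \<Rightarrow> complex" where
  "composition_operator \<phi> f = (\<lambda>z. if z \<in> unit_disk then f (\<phi> z) else 0)"

definition berezin_transform ::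
    "((complex \<Rightarrow> complex) \<Rightarrow> complex \<Rightarrow> complex) \<Rightarrow> complex \<Rightarrow> complex" where
  "berezin_transform T z =
     bergman_inner (T (normalized_bergman_kernel z)) (normalized_bergman_kernel z)"

definition berezin_range :: "((complex \<Rightarrow> complex) \<Rightarrow> complex \<Rightarrow> complex) \<Rightarrow> complex set" where
  "berezin_range T = berezin_transform T ` unit_disk"

definition disk_automorphism :: "complex \<Rightarrow> complex \<Rightarrow> complex" where
  "disk_automorphism a z = (a - z) / (1 - cnj a * z)"

end

theory Submission
  imports Defs
begin

text \<open>
  Since \<open>K\<^sub>z(w) = 1 / (\<pi> (1 - cnj z * w)\<^sup>2)\<close>, the Berezin transform of \<open>C\<^sub>\<phi>\<close> is \<open>q\<^sup>2\<close> with
  \<open>q = (1 - |z|\<^sup>2) / (1 - cnj z * \<phi>(z)) = v (1 - cnj a * z)\<close> for a positive real \<open>v\<close>. Put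
  \<open>s = 1 - |a|\<^sup>2\<close>. Eliminating \<open>z\<close> in favour of \<open>v\<close> shows that, for \<open>a \<noteq> 0\<close>, the values \<open>q\<close> fill the union
  over \<open>v > 0\<close> of the discs \<open>|q|\<^sup>2 \<le> 2 b Re q - s v\<^sup>2\<close> with centre \<open>b = v (1 + s v) / (1 + v)\<close>.
  Write \<open>H(P) = sup\<^sub>v (2 b P - s v\<^sup>2)\<close>; the supremum is attained where \<open>P = s v / b'(v)\<close>. So the Berezin range
  consists of the \<open>w\<close> with \<open>|w| \<le> H(P)\<close>, where \<open>P = Re (csqrt w)\<close>. As \<open>P / b\<close> increases with \<open>v\<close>, \<open>H\<close> is a
  concave function of \<open>P\<^sup>2 = (|w| + Re w) / 2\<close>, and each tangent line of it turns into an inequality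
  \<open>p |w| \<le> c Re w + d\<close>. If \<open>s \<ge> 1/2\<close> all the coefficients \<open>p\<close> are nonnegative and the range is an
  intersection of convex sets. If \<open>s < 1/2\<close>, the range contains two opposite points of the imaginary
  axis but not \<open>0\<close>.

  The reproducing property follows by averaging over circles (Cauchy's formula for the derivative),
  after which the integrand depends only on \<open>|w|\<^sup>2\<close> and is the derivative of \<open>t f(z t)\<close>
  at \<open>t = |w|\<^sup>2\<close>.
\<close>

section \<open>The image of the squared symbol\<close>

definition disc_center :: "real \<Rightarrow> real \<Rightarrow> real" where
  "disc_center s v = v * (1 + s * v) / (1 + v)"

text \<open>The real part at which the disc with parameter \<open>v\<close> touches the envelope, \<open>s v / b'(v)\<close>.\<close>
definition tangency :: "real \<Rightarrow> real \<Rightarrow> real" where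
  "tangency s v = s * v * (1 + v)\<^sup>2 / (1 + 2 * s * v + s * v\<^sup>2)"

text \<open>A point satisfying the inequality for some \<open>v\<close> satisfies it with equality for a smaller \<open>v\<close>.\<close>
definition berezin_region :: "real \<Rightarrow> complex set" where
  "berezin_region s = {w. w \<notin> \<real>\<^sub>\<le>\<^sub>0 \<and>
     (\<exists>v>0. cmod w \<le> 2 * Re (csqrt w) * disc_center s v - s * v\<^sup>2)}"

lemma disc_center_pos: "0 < s \<Longrightarrow> 0 < v \<Longrightarrow> 0 < disc_center s v"
  unfolding disc_center_def by (intro divide_pos_pos mult_pos_pos add_pos_pos) auto

lemma tangency_pos: "0 < s \<Longrightarrow> 0 < v \<Longrightarrow> 0 < tangency s v"
  unfolding tangency_def by (intro divide_pos_pos mult_pos_pos add_pos_pos zero_less_power) auto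

lemma disc_center_less:
  assumes "s < 1" "0 < v"
  shows "disc_center s v < v"
proof -
  have "v * (s * v) < v * v" using assms by (intro mult_strict_left_mono) auto
  then show ?thesis using assms by (simp add: disc_center_def field_simps)
qed

lemma tangency_div_disc_center:
  assumes "0 < s" "0 < y"
  shows "tangency s y / disc_center s y
    = s * (1 + y)^3 / ((1 + 2 * s * y + s * y\<^sup>2) * (1 + s * y))"
proof -
  define E where "E = 1 + 2 * s * y + s * y\<^sup>2"
  define F where "F = 1 + s * y"
  define G where "G = 1 + y"
  have "0 < E" "0 < F" "0 < G"
    unfolding E_def F_def G_def using assms by (auto intro!: add_pos_pos mult_pos_pos)
  then show ?thesis using assms
    unfolding tangency_def disc_center_def E_def[symmetric] F_def[symmetric] G_def[symmetric]
    by (simp add: divide_simps power2_eq_square power3_eq_cube)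
qed

text \<open>For s <= 1 the factors of the denominator in \<open>tangency_div_disc_center\<close> are
  at most (1 + y)^2 and 1 + y, so the slope is at least s. The threshold 1/2 is what makes the
  coefficient 1 - 1/(2 k) of |w| nonnegative in \<open>convex_berezin_region\<close>.\<close>

lemma slope_ge_half:
  assumes "1 / 2 \<le> s" "s \<le> 1" "0 < y"
  shows "1 / 2 \<le> tangency s y / disc_center s y"
proof -
  have pos: "0 < 1 + 2 * s * y + s * y\<^sup>2" "0 < 1 + s * y"
    using assms by (auto intro!: add_pos_pos mult_pos_pos)
  have "s * y \<le> 1 * y" "s * y\<^sup>2 \<le> 1 * y\<^sup>2" using assms by (intro mult_right_mono; simp)+
  then have "(1 + 2 * s * y + s * y\<^sup>2) * (1 + s * y) \<le> (1 + 2 * y + y\<^sup>2) * (1 + y)"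
    using pos assms by (intro mult_mono) linarith+
  also have "\<dots> = (1 + y)^3" by (simp add: power2_eq_square power3_eq_cube algebra_simps)
  also have "\<dots> \<le> 2 * s * (1 + y)^3"
    using assms mult_right_mono[of 1 "2 * s" "(1 + y)^3"] by auto
  finally have le: "(1 + 2 * s * y + s * y\<^sup>2) * (1 + s * y) \<le> 2 * s * (1 + y)^3" .
  show ?thesis
    using le pos assms
    by (subst tangency_div_disc_center) (simp_all add: pos_le_divide_eq del: distrib_left_numeral)
qed

text \<open>The slope of \<open>s v\<^sup>2\<close> as a function of \<open>b\<^sup>2\<close> is \<open>P / b\<close>, so this says that the function is convex.\<close>
lemma slope_square_diff_le:
  assumes s: "0 < s" "s \<le> 1" and x: "0 < x" and y: "0 < y"
  shows "tangency s y / disc_center s y * ((disc_center s x)\<^sup>2 - (disc_center s y)\<^sup>2)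
    \<le> s * (x\<^sup>2 - y\<^sup>2)"
proof -
  define D where "D = (1 + 2 * s * y + s * y\<^sup>2) * (1 + s * y)"
  define A where "A = 1 + s * (x + y) + s * x * y"
  define B where "B = x * (1 + s * x) * (1 + y) + y * (1 + s * y) * (1 + x)"
  \<comment> \<open>After s (x - y) is factored out of the difference of the two sides, the
    remaining bracket vanishes again at x = y: it is (1 - s) (x - y) Q. All coefficients of
    \<open>Q\<close> are nonnegative, so the difference is a square times nonnegative terms.\<close>
  define Q where "Q = y + s * y\<^sup>2 + 2 * x + 2 * (1 + s) * x * y + 2 * s * x * y\<^sup>2
    + (1 + s) * x\<^sup>2 + 3 * s * x\<^sup>2 * y + s * x\<^sup>2 * y\<^sup>2"
  have D: "D > 0" unfolding D_def using s y by (intro mult_pos_pos add_pos_pos) auto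
  have Q: "Q \<ge> 0" unfolding Q_def using s x y by (intro add_nonneg_nonneg mult_nonneg_nonneg) auto
  have diff: "disc_center s x - disc_center s y = (x - y) * A / ((1 + x) * (1 + y))"
    unfolding disc_center_def A_def using x y by (simp add: field_simps)
  have sum: "disc_center s x + disc_center s y = B / ((1 + x) * (1 + y))"
    unfolding disc_center_def B_def using x y by (simp add: field_simps)
  have sq: "(disc_center s x)\<^sup>2 - (disc_center s y)\<^sup>2 = (x - y) * A * B / ((1 + x) * (1 + y))\<^sup>2"
    unfolding power2_eq_square square_diff_square_factored diff sum by (simp add: mult.commute mult.left_commute)
  have "(x + y) * (1 + x)\<^sup>2 * D - (1 + y) * A * B = (1 - s) * (x - y) * Q"
    unfolding A_def B_def D_def Q_def by algebra
  then have key: "(x + y) * (1 + x)\<^sup>2 * D = (1 + y) * A * B + (1 - s) * (x - y) * Q" by simp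
  have "s * (x\<^sup>2 - y\<^sup>2)
      - tangency s y / disc_center s y * ((disc_center s x)\<^sup>2 - (disc_center s y)\<^sup>2)
    = s * (x - y) * ((x + y) * (1 + x)\<^sup>2 * D - (1 + y) * A * B) / ((1 + x)\<^sup>2 * D)"
    unfolding tangency_div_disc_center[OF s(1) y] sq D_def[symmetric] using D x y
    by (simp add: divide_simps) (simp add: power2_eq_square power3_eq_cube algebra_simps)
  also have "\<dots> = s * (1 - s) * (x - y)\<^sup>2 * Q / ((1 + x)\<^sup>2 * D)"
    unfolding key by (simp add: power2_eq_square)
  also have "\<dots> \<ge> 0" using s Q D x by (intro divide_nonneg_nonneg mult_nonneg_nonneg) auto
  finally show ?thesis by simp
qed

text \<open>Completing the square bounds 2 P b(x) by P^2/k + k b(x)^2, and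
  \<open>slope_square_diff_le\<close> moves the rest from x to y. The right side is affine in P^2
  and agrees with the left side for x = y and P = \<open>tangency s y\<close>: it is a tangent line
  of H.\<close>

lemma disc_le_tangent:
  assumes s: "0 < s" "s \<le> 1" and x: "0 < x" and y: "0 < y"
  shows "2 * P * disc_center s x - s * x\<^sup>2
    \<le> P\<^sup>2 / (tangency s y / disc_center s y) + tangency s y * disc_center s y - s * y\<^sup>2"
proof -
  define k where "k = tangency s y / disc_center s y"
  have k: "k > 0" unfolding k_def using disc_center_pos[OF s(1) y] tangency_pos[OF s(1) y] by simp
  have t: "tangency s y = k * disc_center s y"
    unfolding k_def using disc_center_pos[OF s(1) y] by simp
  have "0 \<le> k * (P / k - disc_center s x)\<^sup>2" using k by simp
  also have "\<dots> = P\<^sup>2 / k - 2 * P * disc_center s x + k * (disc_center s x)\<^sup>2"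
    using k by (simp add: field_simps power2_eq_square)
  finally have "2 * P * disc_center s x \<le> P\<^sup>2 / k + k * (disc_center s x)\<^sup>2" by simp
  moreover have "k * ((disc_center s x)\<^sup>2 - (disc_center s y)\<^sup>2) \<le> s * (x\<^sup>2 - y\<^sup>2)"
    unfolding k_def by (rule slope_square_diff_le[OF assms])
  ultimately show ?thesis
    unfolding k_def[symmetric] unfolding t by (simp only: power2_eq_square algebra_simps)
qed

lemma tangency_surj:
  assumes s: "0 < s" "s \<le> 1" and P: "0 < P"
  obtains y where "0 < y" "tangency s y = P"
proof -
  have den: "1 + 2 * s * y + s * y\<^sup>2 > 0" if "y \<ge> 0" for y
    using s that by (intro add_pos_nonneg) auto
  have "continuous_on {0..P / s} (tangency s)"
    unfolding tangency_def using den by (intro continuous_intros) force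
  moreover have "tangency s 0 \<le> P" using P by (simp add: tangency_def)
  \<comment> \<open>At y = P/s the factor s y equals P, and (1 + y)^2 / (1 + 2 s y + s y^2) is at
    least 1 because s <= 1.\<close>
  moreover have "P \<le> tangency s (P / s)"
  proof -
    define V where "V = P / s"
    have V: "V > 0" using s P by (simp add: V_def)
    have "s * V \<le> 1 * V" "s * V\<^sup>2 \<le> 1 * V\<^sup>2" using s V by (intro mult_right_mono; simp)+
    then have "1 + 2 * s * V + s * V\<^sup>2 \<le> (1 + V)\<^sup>2" by (simp add: power2_eq_square algebra_simps)
    then have "P * (1 + 2 * s * V + s * V\<^sup>2) \<le> P * (1 + V)\<^sup>2" using P by (intro mult_left_mono) auto
    moreover have "P = s * V" using s by (simp add: V_def)
    ultimately have "P \<le> tangency s V"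
      using den[of V] V unfolding tangency_def by (simp add: pos_le_divide_eq)
    then show ?thesis by (simp add: V_def)
  qed
  ultimately obtain y where y: "0 \<le> y" "tangency s y = P"
    using IVT'[of "tangency s" 0 P "P / s"] s P by auto
  moreover have "y \<noteq> 0" using y P by (auto simp: tangency_def)
  ultimately show thesis by (intro that[of y]) auto
qed

section \<open>Convexity of the region for s >= 1/2\<close>

lemma Re_csqrt_power2: "2 * (Re (csqrt w))\<^sup>2 = cmod w + Re w"
proof -
  have "0 \<le> cmod w + Re w" using abs_Re_le_cmod[of w] by linarith
  then show ?thesis by simp
qed

lemma Re_csqrt_pos: "w \<notin> \<real>\<^sub>\<le>\<^sub>0 \<Longrightarrow> 0 < Re (csqrt w)"
proof -
  assume "w \<notin> \<real>\<^sub>\<le>\<^sub>0"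
  moreover have "w \<in> \<real>\<^sub>\<le>\<^sub>0" if "cmod w = - Re w"
    using that cmod_power2[of w] norm_ge_zero[of w] by (auto simp: complex_nonpos_Reals_iff)
  ultimately have "0 < cmod w + Re w" using abs_Re_le_cmod[of w] by fastforce
  then show ?thesis by simp
qed

text \<open>For p >= 0 the left side is convex in w, while the right side is affine. For p > 0 the
  boundary is in general part of a conic with focus 0.\<close>

lemma convex_focal_region:
  assumes "0 \<le> p"
  shows "convex {w. p * cmod w \<le> c * Re w + d}"
proof (rule convexI)
  fix x y :: complex and u v :: real
  assume x: "x \<in> {w. p * cmod w \<le> c * Re w + d}" and y: "y \<in> {w. p * cmod w \<le> c * Re w + d}"
    and uv: "0 \<le> u" "0 \<le> v" "u + v = 1"
  have "cmod (u *\<^sub>R x + v *\<^sub>R y) \<le> u * cmod x + v * cmod y"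
    using norm_triangle_ineq[of "u *\<^sub>R x" "v *\<^sub>R y"] uv by simp
  then have "p * cmod (u *\<^sub>R x + v *\<^sub>R y) \<le> u * (p * cmod x) + v * (p * cmod y)"
    using assms mult_left_mono by (fastforce simp: algebra_simps)
  also have "\<dots> \<le> u * (c * Re x + d) + v * (c * Re y + d)"
    using x y uv by (intro add_mono mult_left_mono) auto
  also have "\<dots> = c * Re (u *\<^sub>R x + v *\<^sub>R y) + (u + v) * d" by (simp add: algebra_simps)
  finally show "u *\<^sub>R x + v *\<^sub>R y \<in> {w. p * cmod w \<le> c * Re w + d}" using uv by simp
qed

text \<open>From b(v) < v and 2 P v <= 2 P^2 + v^2/2 one gets |w| < 2 P^2 = |w| + Re w once s >=
  1/2. The half plane can then replace the slit plane of the definition, which is not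
  convex.\<close>

lemma berezin_region_Re_pos:
  assumes s: "1 / 2 \<le> s" "s < 1" and w: "w \<in> berezin_region s"
  shows "0 < Re w"
proof -
  define P where "P = Re (csqrt w)"
  from w obtain v where v: "0 < v" "cmod w \<le> 2 * P * disc_center s v - s * v\<^sup>2"
    and P: "0 < P" unfolding berezin_region_def P_def using Re_csqrt_pos by blast
  have "P * disc_center s v < P * v" using disc_center_less[OF s(2) v(1)] P by simp
  then have "cmod w < 2 * P * v - s * v\<^sup>2" using v(2) by linarith
  moreover have "2 * P * v \<le> 2 * P\<^sup>2 + (1 / 2) * v\<^sup>2"
    using zero_le_power2[of "2 * P - v"] by (simp add: power2_eq_square algebra_simps)
  moreover have "(1 / 2) * v\<^sup>2 \<le> s * v\<^sup>2" using s by (intro mult_right_mono) auto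
  ultimately have "cmod w < 2 * P\<^sup>2" by linarith
  then show ?thesis unfolding P_def Re_csqrt_power2 by simp
qed

lemma convex_berezin_region:
  assumes s: "1 / 2 \<le> s" "s < 1"
  shows "convex (berezin_region s)"
proof -
  define k where "k = (\<lambda>y. tangency s y / disc_center s y)"
  define e where "e = (\<lambda>y. tangency s y * disc_center s y - s * y\<^sup>2)"
  \<comment> \<open>Substituting P^2 = (|w| + Re w)/2 into the tangent inequality |w| <= P^2/k + e
    and collecting the multiples of |w| gives this form.\<close>
  define H where "H = (\<lambda>y. {w. (1 - 1 / (2 * k y)) * cmod w \<le> 1 / (2 * k y) * Re w + e y})"
  have k: "k y \<ge> 1 / 2" if "0 < y" for y
    unfolding k_def using s that by (intro slope_ge_half) auto
  have H_iff: "w \<in> H y \<longleftrightarrow> cmod w \<le> (Re (csqrt w))\<^sup>2 / k y + e y" for w y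
  proof -
    define p where "p = 1 / (2 * k y)"
    have "(Re (csqrt w))\<^sup>2 / k y = p * (2 * (Re (csqrt w))\<^sup>2)"
      by (simp add: p_def del: csqrt.sel)
    then have "(Re (csqrt w))\<^sup>2 / k y = p * (cmod w + Re w)" unfolding Re_csqrt_power2 .
    then show ?thesis unfolding H_def p_def[symmetric]
      by (simp add: algebra_simps del: csqrt.sel)
  qed
  have "convex ({w. Re w > 0} \<inter> (\<Inter>y\<in>{0<..}. H y))"
  proof (intro convex_Int convex_INT)
    show "convex {w. 0 < Re w}" by (rule convex_halfspace_Re_gt)
    fix y :: real assume "y \<in> {0<..}"
    then have "0 \<le> 1 - 1 / (2 * k y)" using k[of y] by (auto simp: field_simps)
    then show "convex (H y)" unfolding H_def by (rule convex_focal_region)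
  qed
  moreover have "berezin_region s = {w. Re w > 0} \<inter> (\<Inter>y\<in>{0<..}. H y)"
  proof (intro equalityI subsetI)
    fix w assume w: "w \<in> berezin_region s"
    then obtain v where v: "0 < v" "cmod w \<le> 2 * Re (csqrt w) * disc_center s v - s * v\<^sup>2"
      by (auto simp: berezin_region_def)
    have "w \<in> H y" if "0 < y" for y
      unfolding H_iff k_def e_def
      using v disc_le_tangent[of s v y "Re (csqrt w)"] s that by auto
    then show "w \<in> {w. Re w > 0} \<inter> (\<Inter>y\<in>{0<..}. H y)"
      using berezin_region_Re_pos[OF s w] by simp
  next
    fix w assume w: "w \<in> {w. Re w > 0} \<inter> (\<Inter>y\<in>{0<..}. H y)"
    then have w0: "w \<notin> \<real>\<^sub>\<le>\<^sub>0" by (auto simp: complex_nonpos_Reals_iff)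
    define P where "P = Re (csqrt w)"
    have P: "P > 0" unfolding P_def by (rule Re_csqrt_pos[OF w0])
    \<comment> \<open>The tangent line that touches at P: for this y the bound in \<open>H y\<close>
      is the value of the disc function at v = y, so y itself witnesses membership.\<close>
    obtain y where y: "0 < y" "tangency s y = P" using tangency_surj[of s P] s P by auto
    have "cmod w \<le> P\<^sup>2 / k y + e y" using w y H_iff unfolding P_def by auto
    also have "\<dots> = 2 * P * disc_center s y - s * y\<^sup>2"
      unfolding k_def e_def y using P disc_center_pos[of s y] s y
      by (simp add: power2_eq_square field_simps)
    finally show "w \<in> berezin_region s" using w0 y unfolding berezin_region_def P_def by auto
  qed
  ultimately show ?thesis by simp
qed

section \<open>The symbol and the image of its square\<close>

text \<open>This is (1 - |z|^2) / (1 - cnj z phi(z)) for the automorphism phi, with the denominator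
  of phi moved up. The first factor is then real and positive on the disk.\<close>

definition berezin_symbol :: "complex \<Rightarrow> complex \<Rightarrow> complex" where
  "berezin_symbol a z = of_real ((1 - (cmod z)\<^sup>2) / (1 + (cmod z)\<^sup>2 - 2 * Re (cnj a * z)))
     * (1 - cnj a * z)"

lemma norm_mult_disk:
  assumes "cmod a < 1" "cmod z < 1"
  shows "cmod (cnj a * z) < 1" "2 * Re (cnj a * z) < 1 + (cmod z)\<^sup>2"
proof -
  have "cmod (cnj a * z) \<le> cmod z"
    using assms mult_right_mono[of "cmod a" 1 "cmod z"] by (simp add: norm_mult)
  then show "cmod (cnj a * z) < 1" using assms by simp
  have "2 * cmod z < 1 + (cmod z)\<^sup>2"
    using assms zero_less_power[of "1 - cmod z" 2] by (simp add: power2_eq_square algebra_simps)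
  then show "2 * Re (cnj a * z) < 1 + (cmod z)\<^sup>2"
    using \<open>cmod (cnj a * z) \<le> cmod z\<close> complex_Re_le_cmod[of "cnj a * z"] by linarith
qed

lemma cmod_one_minus_power2: "(cmod (1 - c))\<^sup>2 = 1 - 2 * Re c + (cmod c)\<^sup>2"
  unfolding cmod_power2 by (simp add: power2_eq_square algebra_simps)

lemma Re_berezin_symbol_pos:
  assumes "cmod a < 1" "cmod z < 1"
  shows "0 < Re (berezin_symbol a z)"
proof -
  have "(cmod z)\<^sup>2 < 1" using assms by (simp add: power_less_one_iff abs_square_less_1)
  moreover have "Re (cnj a * z) < 1"
    using norm_mult_disk(1)[OF assms] complex_Re_le_cmod[of "cnj a * z"] by linarith
  moreover have "Re (berezin_symbol a z)
    = (1 - (cmod z)\<^sup>2) / (1 + (cmod z)\<^sup>2 - 2 * Re (cnj a * z)) * (1 - Re (cnj a * z))"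
    unfolding berezin_symbol_def by simp
  ultimately show ?thesis
    using norm_mult_disk(2)[OF assms] by (simp only:) (intro mult_pos_pos divide_pos_pos; linarith)
qed

text \<open>The real part is positive, so the principal root undoes the squaring, and the P of
  \<open>berezin_region\<close> is the real part of the symbol.\<close>

lemma csqrt_berezin_symbol_power2:
  assumes "cmod a < 1" "cmod z < 1"
  shows "csqrt ((berezin_symbol a z)\<^sup>2) = berezin_symbol a z"
  using Re_berezin_symbol_pos[OF assms] by (intro csqrt_unique) auto

lemma berezin_symbol_power2_notin:
  assumes "cmod a < 1" "cmod z < 1"
  shows "(berezin_symbol a z)\<^sup>2 \<notin> \<real>\<^sub>\<le>\<^sub>0"
proof
  assume "(berezin_symbol a z)\<^sup>2 \<in> \<real>\<^sub>\<le>\<^sub>0"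
  then have "Re (csqrt ((berezin_symbol a z)\<^sup>2)) = 0"
    by (auto simp: complex_nonpos_Reals_iff cmod_def abs_if)
  then show False using csqrt_berezin_symbol_power2[OF assms] Re_berezin_symbol_pos[OF assms] by simp
qed

lemma berezin_symbol_image:
  assumes a: "cmod a < 1" "a \<noteq> 0"
  shows "(\<lambda>z. (berezin_symbol a z)\<^sup>2) ` ball 0 1 = berezin_region (1 - (cmod a)\<^sup>2)"
proof (intro equalityI subsetI)
  define s where "s = 1 - (cmod a)\<^sup>2"
  have r2: "(cmod a)\<^sup>2 = 1 - s" by (simp add: s_def)
  fix w assume "w \<in> (\<lambda>z. (berezin_symbol a z)\<^sup>2) ` ball 0 1"
  then obtain z where z: "cmod z < 1" and w: "w = (berezin_symbol a z)\<^sup>2" by auto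
  define X where "X = Re (cnj a * z)"
  define m where "m = (cmod z)\<^sup>2"
  define v where "v = (1 - m) / (1 + m - 2 * X)"
  have m: "m < 1" using z unfolding m_def by (simp add: abs_square_less_1)
  have den: "0 < 1 + m - 2 * X" using norm_mult_disk(2)[OF a(1) z] by (simp add: m_def X_def)
  have v: "v > 0" using m den by (simp add: v_def)
  have q: "berezin_symbol a z = of_real v * (1 - cnj a * z)"
    by (simp add: berezin_symbol_def v_def m_def X_def)
  have P: "Re (csqrt w) = v * (1 - X)"
    unfolding w csqrt_berezin_symbol_power2[OF a(1) z] unfolding q X_def by simp
  have N: "cmod w = v\<^sup>2 * (1 - 2 * X + (1 - s) * m)"
    unfolding w norm_power q norm_mult power_mult_distrib cmod_one_minus_power2
    by (simp add: X_def m_def r2 norm_mult power_mult_distrib)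
  \<comment> \<open>The definition of v, solved for m. Multiplying |w| by 1 + v lets m be
    eliminated, and for fixed v the result is affine in X, hence in P.\<close>
  have rel: "m * (1 + v) = 1 - v + 2 * v * X" 
  proof -
    have "v * (1 + m - 2 * X) = 1 - m" using den by (simp add: v_def)
    then show ?thesis by (simp add: algebra_simps)
  qed
  have "cmod w = 2 * Re (csqrt w) * disc_center s v - s * v\<^sup>2"
  proof -
    have "cmod w * (1 + v) = v\<^sup>2 * ((1 - 2 * X) * (1 + v) + (1 - s) * (m * (1 + v)))"
      unfolding N by algebra
    also have "\<dots> = 2 * (v * (1 - X)) * (v * (1 + s * v)) - s * v\<^sup>2 * (1 + v)"
      unfolding rel by algebra
    finally show ?thesis unfolding P disc_center_def using v by (simp add: field_simps)
  qed
  then show "w \<in> berezin_region s"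
    unfolding berezin_region_def using v berezin_symbol_power2_notin[OF a(1) z] w by auto
next
  define s where "s = 1 - (cmod a)\<^sup>2"
  have r2: "(cmod a)\<^sup>2 = 1 - s" by (simp add: s_def)
  have s: "0 < s" "s < 1" using a by (auto simp: s_def abs_square_less_1)
  fix w assume "w \<in> berezin_region s"
  then obtain v0 where w0: "w \<notin> \<real>\<^sub>\<le>\<^sub>0" and v0: "v0 > 0"
    "cmod w \<le> 2 * Re (csqrt w) * disc_center s v0 - s * v0\<^sup>2" by (auto simp: berezin_region_def)
  define q where "q = csqrt w"
  define P where "P = Re q"
  have P: "P > 0" unfolding P_def q_def by (rule Re_csqrt_pos[OF w0])
  have q2: "q\<^sup>2 = w" by (simp add: q_def)
  \<comment> \<open>The disc function is 0 at 0 and at least |w| at v0, so some v in between gives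
    the equality that a point of the image satisfies.\<close>
  have "continuous_on {0..v0} (\<lambda>v. 2 * P * disc_center s v - s * v\<^sup>2)"
    unfolding disc_center_def by (intro continuous_intros) auto
  then obtain v where v: "0 \<le> v" "2 * P * disc_center s v - s * v\<^sup>2 = cmod w"
    using IVT'[of "\<lambda>v. 2 * P * disc_center s v - s * v\<^sup>2" 0 "cmod w" v0] v0
    by (auto simp: disc_center_def P_def q_def)
  have "v \<noteq> 0" using v w0 by (auto simp: disc_center_def)
  then have vp: "v > 0" using v by simp
  \<comment> \<open>Solves q = v (1 - cnj a z) for z. That z lies in the disk and that v is its
    scalar factor both follow from |z|^2 = 1 - 2 P / (1 + v).\<close>
  define z where "z = (1 - q / of_real v) / cnj a"
  have az: "cnj a * z = 1 - q / of_real v" using a by (simp add: z_def)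
  have Reaz: "Re (cnj a * z) = 1 - P / v" unfolding az P_def by simp
  have N: "(cmod q)\<^sup>2 = 2 * P * disc_center s v - s * v\<^sup>2"
    unfolding norm_power[symmetric] q2 v(2) ..
  have "(1 - s) * (cmod z)\<^sup>2 = (cmod (1 - q / of_real v))\<^sup>2"
    unfolding az[symmetric] by (simp add: norm_mult power_mult_distrib r2)
  also have "\<dots> = 1 - 2 * P / v + (cmod q)\<^sup>2 / v\<^sup>2"
    unfolding cmod_one_minus_power2 by (simp add: P_def norm_divide power_divide)
  also have "\<dots> = (1 - s) * (1 - 2 * P / (1 + v))"
    unfolding N disc_center_def using vp
    by (simp add: divide_simps) (simp add: power2_eq_square algebra_simps)
  finally have m: "(cmod z)\<^sup>2 = 1 - 2 * P / (1 + v)" using s by simp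
  have "2 * P / (1 + v) > 0" using P vp by simp
  then have "(cmod z)\<^sup>2 < 1" using m by linarith
  then have z: "z \<in> ball 0 1" by (simp add: abs_square_less_1)
  have "(1 - (cmod z)\<^sup>2) / (1 + (cmod z)\<^sup>2 - 2 * Re (cnj a * z)) = v"
    unfolding m Reaz using P vp by (simp add: divide_simps) (simp add: algebra_simps)
  then have "berezin_symbol a z = q"
    unfolding berezin_symbol_def az using vp by simp
  then show "w \<in> (\<lambda>z. (berezin_symbol a z)\<^sup>2) ` ball 0 1" using z q2 by (metis imageI)
qed

section \<open>Failure of convexity, and the case a = 0\<close>

lemma not_convex_berezin_symbol_image:
  assumes a: "cmod a < 1" "1 / 2 < (cmod a)\<^sup>2"
  shows "\<not> convex ((\<lambda>z. (berezin_symbol a z)\<^sup>2) ` ball 0 1)"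
proof
  assume conv: "convex ((\<lambda>z. (berezin_symbol a z)\<^sup>2) ` ball 0 1)"
  \<comment> \<open>The scalar factor of the symbol at points with |z|^2 = 1/(2 |a|^2) and Re (cnj a
    z) = 1/2. Such points lie in the disk because |a|^2 > 1/2.\<close>
  define v where "v = (1 - 1 / (2 * (cmod a)\<^sup>2)) / (1 + 1 / (2 * (cmod a)\<^sup>2) - 2 * (1 / 2))"
  have a0: "a \<noteq> 0" using a by auto
  have mem: "(of_real v * (1 - c))\<^sup>2 \<in> (\<lambda>z. (berezin_symbol a z)\<^sup>2) ` ball 0 1"
    if c: "Re c = 1 / 2" "(cmod c)\<^sup>2 = 1 / 2" for c
  proof -
    have ac: "cnj a * (c / cnj a) = c" using a0 by simp
    have m: "(cmod (c / cnj a))\<^sup>2 = 1 / (2 * (cmod a)\<^sup>2)"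
      using c(2) by (simp only: norm_divide power_divide complex_mod_cnj divide_divide_eq_left)
    have "1 / (2 * (cmod a)\<^sup>2) < 1" using a by (simp add: divide_less_eq)
    then have "(cmod (c / cnj a))\<^sup>2 < 1" unfolding m .
    then have "c / cnj a \<in> ball 0 1" by (simp only: abs_square_less_1 mem_ball_0 abs_norm_cancel)
    moreover have "berezin_symbol a (c / cnj a) = of_real v * (1 - c)"
      unfolding berezin_symbol_def ac m c(1) v_def ..
    ultimately show ?thesis by (metis imageI)
  qed
  \<comment> \<open>For c = (1 + i)/2 and c = (1 - i)/2 the square of 1 - c is -i/2 and i/2, so the
    two values are opposite and their midpoint is 0.\<close>
  define w where "w = (of_real v * (1 - Complex (1 / 2) (1 / 2)))\<^sup>2"
  define w' where "w' = (of_real v * (1 - Complex (1 / 2) (- 1 / 2)))\<^sup>2"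
  have "w \<in> (\<lambda>z. (berezin_symbol a z)\<^sup>2) ` ball 0 1"
    unfolding w_def by (rule mem, simp) (subst cmod_power2, simp add: power2_eq_square)
  moreover have "w' \<in> (\<lambda>z. (berezin_symbol a z)\<^sup>2) ` ball 0 1"
    unfolding w'_def by (rule mem, simp) (subst cmod_power2, simp add: power2_eq_square)
  ultimately have "(1 / 2) *\<^sub>R w + (1 / 2) *\<^sub>R w' \<in> (\<lambda>z. (berezin_symbol a z)\<^sup>2) ` ball 0 1"
    by (rule convexD[OF conv]) auto
  moreover have "(1 / 2) *\<^sub>R w + (1 / 2) *\<^sub>R w' = 0"
    unfolding w_def w'_def power_mult_distrib by (simp add: complex_eq_iff power2_eq_square)
  ultimately have "0 \<in> (\<lambda>z. (berezin_symbol a z)\<^sup>2) ` ball 0 1" by (simp only:)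
  then obtain z where z: "z \<in> ball 0 1" "0 = (berezin_symbol a z)\<^sup>2" by (rule imageE)
  then show False using Re_berezin_symbol_pos[OF a(1), of z] by auto
qed

text \<open>A separate case because \<open>berezin_symbol_image\<close> recovers z by dividing by
  cnj a. Here the symbol is real and depends on |z| alone.\<close>

lemma berezin_symbol_zero_image:
  "(\<lambda>z. (berezin_symbol 0 z)\<^sup>2) ` ball 0 1 = of_real ` {0<..1}"
proof (intro equalityI subsetI)
  fix w assume "w \<in> (\<lambda>z. (berezin_symbol 0 z)\<^sup>2) ` ball 0 1"
  then obtain z where z: "cmod z < 1" and w: "w = (berezin_symbol 0 z)\<^sup>2" by auto
  define t where "t = (1 - (cmod z)\<^sup>2) / (1 + (cmod z)\<^sup>2)"
  have "(cmod z)\<^sup>2 < 1" using z by (simp add: abs_square_less_1)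
  then have "0 < t" unfolding t_def by (intro divide_pos_pos add_pos_nonneg) auto
  moreover have "t \<le> 1" unfolding t_def by (subst pos_divide_le_eq) (auto intro: add_pos_nonneg)
  ultimately have "t\<^sup>2 \<in> {0<..1}" by (simp add: power_le_one)
  moreover have "w = of_real (t\<^sup>2)" by (simp add: w berezin_symbol_def t_def)
  ultimately show "w \<in> of_real ` {0<..1}" by blast
next
  fix w :: complex assume "w \<in> of_real ` {0<..1}"
  then obtain x where x: "0 < x" "x \<le> 1" and w: "w = of_real x" by auto
  define t where "t = sqrt x"
  have t: "0 < t" "t \<le> 1" "t\<^sup>2 = x" using x by (auto simp: t_def)
  \<comment> \<open>The map m -> (1 - m)/(1 + m) is its own inverse, so this |z|^2 produces the
    value t.\<close>
  define z where "z = complex_of_real (sqrt ((1 - t) / (1 + t)))"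
  have m: "(cmod z)\<^sup>2 = (1 - t) / (1 + t)" using t by (simp add: z_def)
  have "(cmod z)\<^sup>2 < 1" unfolding m using t by simp
  then have "z \<in> ball 0 1" by (simp add: abs_square_less_1)
  moreover have "(1 - (cmod z)\<^sup>2) / (1 + (cmod z)\<^sup>2) = t"
    unfolding m using t by (simp add: divide_simps)
  then have "(berezin_symbol 0 z)\<^sup>2 = w" using t by (simp add: berezin_symbol_def w of_real_power[symmetric] del: of_real_power)
  ultimately show "w \<in> (\<lambda>z. (berezin_symbol 0 z)\<^sup>2) ` ball 0 1" by (metis imageI)
qed

theorem convex_berezin_symbol_image_iff:
  assumes a: "cmod a < 1"
  shows "convex ((\<lambda>z. (berezin_symbol a z)\<^sup>2) ` ball 0 1) \<longleftrightarrow> cmod a \<le> sqrt 2 / 2"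
proof -
  have iff: "cmod a \<le> sqrt 2 / 2 \<longleftrightarrow> (cmod a)\<^sup>2 \<le> 1 / 2"
  proof -
    have "cmod a \<le> sqrt 2 / 2 \<longleftrightarrow> (cmod a)\<^sup>2 \<le> (sqrt 2 / 2)\<^sup>2"
      by (rule power_mono_iff[symmetric]) auto
    then show ?thesis by (simp add: power_divide)
  qed
  show ?thesis
  proof (cases "a = 0")
    case True
    have "convex (complex_of_real ` {0<..1})"
      by (intro convex_linear_image bounded_linear.linear bounded_linear_of_real) auto
    then show ?thesis using True by (simp add: berezin_symbol_zero_image)
  next
    case False
    then show ?thesis
      using not_convex_berezin_symbol_image[OF a] convex_berezin_region[of "1 - (cmod a)\<^sup>2"]
        berezin_symbol_image[OF a False] iff by fastforce
  qed
qed

section \<open>The reproducing kernel\<close>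

lemma borel_measurable_Complex [measurable]:
  assumes [measurable]: "f \<in> borel_measurable M" "g \<in> borel_measurable M"
  shows "(\<lambda>x. Complex (f x) (g x)) \<in> borel_measurable M"
  unfolding Complex_eq by measurable

text \<open>A measure that gives every box its volume is Lebesgue measure. The product form makes
  iterated integration in x and y available.\<close>

lemma lborel_complex: "(lborel :: complex measure)
  = distr (lborel \<Otimes>\<^sub>M lborel) borel (\<lambda>p. Complex (fst p) (snd p))"
proof (rule lborel_eqI)
  fix l u :: complex assume le: "\<And>b. b \<in> Basis \<Longrightarrow> l \<bullet> b \<le> u \<bullet> b"
  have lu: "Re l \<le> Re u" "Im l \<le> Im u" using le[of 1] le[of \<i>] by (auto simp: Basis_complex_def)
  have "(\<lambda>p. Complex (fst p) (snd p)) -` box l u \<inter> space (lborel \<Otimes>\<^sub>M lborel)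
    = {Re l<..<Re u} \<times> {Im l<..<Im u}"
    by (auto simp: box_def Basis_complex_def space_pair_measure)
  then have "emeasure (distr (lborel \<Otimes>\<^sub>M lborel) borel (\<lambda>p. Complex (fst p) (snd p))) (box l u)
    = emeasure (lborel \<Otimes>\<^sub>M lborel) ({Re l<..<Re u} \<times> {Im l<..<Im u})"
    by (subst emeasure_distr) auto
  also have "\<dots> = ennreal (Re u - Re l) * ennreal (Im u - Im l)"
    by (subst lborel.emeasure_pair_measure_Times) (auto simp: lu)
  also have "\<dots> = (\<Prod>b\<in>Basis. (u - l) \<bullet> b)"
    using lu by (simp add: Basis_complex_def ennreal_mult)
  finally show "emeasure (distr (lborel \<Otimes>\<^sub>M lborel) borel (\<lambda>p. Complex (fst p) (snd p))) (box l u)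
    = (\<Prod>b\<in>Basis. (u - l) \<bullet> b)" .
qed simp

text \<open>Both orders occur because the rotation argument substitutes first in x and then in y,
  each time in the inner integral.\<close>

lemma nn_integral_complex:
  assumes [measurable]: "f \<in> borel_measurable borel"
  shows "(\<integral>\<^sup>+z. f z \<partial>lborel) = (\<integral>\<^sup>+x. (\<integral>\<^sup>+y. f (Complex x y) \<partial>lborel) \<partial>lborel)"
    and "(\<integral>\<^sup>+z. f z \<partial>lborel) = (\<integral>\<^sup>+y. (\<integral>\<^sup>+x. f (Complex x y) \<partial>lborel) \<partial>lborel)"
proof -
  have 1: "(\<integral>\<^sup>+z. f z \<partial>lborel) = (\<integral>\<^sup>+p. f (Complex (fst p) (snd p)) \<partial>(lborel \<Otimes>\<^sub>M lborel))"
    by (subst lborel_complex) (simp add: nn_integral_distr)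
  show "(\<integral>\<^sup>+z. f z \<partial>lborel) = (\<integral>\<^sup>+x. (\<integral>\<^sup>+y. f (Complex x y) \<partial>lborel) \<partial>lborel)"
    unfolding 1 by (subst lborel.nn_integral_fst[symmetric]) auto
  show "(\<integral>\<^sup>+z. f z \<partial>lborel) = (\<integral>\<^sup>+y. (\<integral>\<^sup>+x. f (Complex x y) \<partial>lborel) \<partial>lborel)"
    unfolding 1 by (subst lborel_pair.nn_integral_snd[symmetric]) auto
qed

text \<open>A rotation with \<open>Re u \<noteq> 0\<close> is a composition of two maps, each affine in one coordinate.\<close>
lemma nn_integral_rotate_aux:
  assumes [measurable]: "f \<in> borel_measurable borel" and u: "cmod u = 1" "Re u \<noteq> 0"
  shows "(\<integral>\<^sup>+z. f (u * z) \<partial>lborel) = (\<integral>\<^sup>+z. f z \<partial>lborel)"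
proof -
  define c s where "c = Re u" and "s = Im u"
  have c: "c \<noteq> 0" and cs: "c\<^sup>2 + s\<^sup>2 = 1"
    using u cmod_power2[of u] by (auto simp: c_def s_def)
  have uz: "u * Complex x y = Complex (c * x - s * y) (s * x + c * y)" for x y
    by (simp add: complex_eq_iff c_def s_def)
  \<comment> \<open>Replacing x by (x + s y)/c turns the first coordinate into x and, by c^2 + s^2 =
    1, the second into (s x + y)/c. The factor |1/c| is absorbed by the substitution in y in
    \<open>outer\<close>.\<close>
  have inner: "(\<integral>\<^sup>+x. f (Complex (c * x - s * y) (s * x + c * y)) \<partial>lborel)
     = (\<integral>\<^sup>+x. ennreal \<bar>1 / c\<bar> * f (Complex x (s / c * x + 1 / c * y)) \<partial>lborel)" for y
  proof -
    have *: "s * (s / c * y + 1 / c * x) + c * y = s / c * x + 1 / c * y" for x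
    proof -
      have "s * (s / c * y + 1 / c * x) + c * y = s / c * x + ((c\<^sup>2 + s\<^sup>2) / c) * y"
        using c by (simp add: field_simps power2_eq_square)
      then show ?thesis by (simp add: cs)
    qed
    have **: "c * (s / c * y + 1 / c * x) - s * y = x" for x using c by (simp add: field_simps)
    have "(\<integral>\<^sup>+x. f (Complex (c * x - s * y) (s * x + c * y)) \<partial>lborel)
      = ennreal \<bar>1 / c\<bar> * (\<integral>\<^sup>+x. f (Complex (c * (s / c * y + 1 / c * x) - s * y)
          (s * (s / c * y + 1 / c * x) + c * y)) \<partial>lborel)"
      by (rule nn_integral_real_affine) (use c in auto)
    then show ?thesis unfolding * ** by (simp add: nn_integral_cmult)
  qed
  have outer: "(\<integral>\<^sup>+y. ennreal \<bar>1 / c\<bar> * f (Complex x (s / c * x + 1 / c * y)) \<partial>lborel)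
     = (\<integral>\<^sup>+y. f (Complex x y) \<partial>lborel)" for x
    using nn_integral_real_affine[of "\<lambda>y. f (Complex x y)" "1 / c" "s / c * x"] c
    by (simp add: nn_integral_cmult)
  have "(\<integral>\<^sup>+z. f (u * z) \<partial>lborel) = (\<integral>\<^sup>+y. (\<integral>\<^sup>+x. f (u * Complex x y) \<partial>lborel) \<partial>lborel)"
    by (rule nn_integral_complex(2)) measurable
  also have "\<dots> = (\<integral>\<^sup>+y. (\<integral>\<^sup>+x. ennreal \<bar>1 / c\<bar> * f (Complex x (s / c * x + 1 / c * y)) \<partial>lborel) \<partial>lborel)"
    unfolding uz inner ..
  also have "\<dots> = (\<integral>\<^sup>+x. (\<integral>\<^sup>+y. ennreal \<bar>1 / c\<bar> * f (Complex x (s / c * x + 1 / c * y)) \<partial>lborel) \<partial>lborel)"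
    by (rule lborel_pair.Fubini') measurable
  also have "\<dots> = (\<integral>\<^sup>+z. f z \<partial>lborel)"
    unfolding outer by (rule nn_integral_complex(1)[symmetric]) measurable
  finally show ?thesis .
qed

lemma distr_lborel_rotate:
  assumes u: "cmod u = 1"
  shows "distr lborel borel (\<lambda>z. u * z) = (lborel :: complex measure)"
proof (rule measure_eqI)
  fix A assume "A \<in> sets (distr lborel borel (\<lambda>z. u * z))"
  then have A [measurable]: "A \<in> sets borel" by simp
  have inv: "(\<integral>\<^sup>+z. indicator A (u * z) \<partial>lborel) = emeasure lborel A"
  proof (cases "Re u = 0")
    case False
    then show ?thesis using nn_integral_rotate_aux[of "indicator A" u] u by simp
  next
    case True
    \<comment> \<open>A quarter turn is the square of a rotation with nonzero real part: if Re v
      were 0, then u = v^2 would be real, hence 0.\<close>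
    define v where "v = csqrt u"
    have v2: "v * v = u" unfolding v_def by (metis power2_csqrt power2_eq_square)
    have "(cmod v)\<^sup>2 = 1\<^sup>2" using u by (simp flip: norm_power add: v_def)
    then have v: "cmod v = 1" by (rule power2_eq_imp_eq) auto
    have "Re v \<noteq> 0"
    proof
      assume "Re v = 0"
      then have "Im u = 0" by (simp flip: v2)
      then show False using True u by (simp add: complex_eq_iff cmod_def)
    qed
    then have "(\<integral>\<^sup>+z. indicator A (v * (v * z)) \<partial>lborel) = emeasure lborel A"
      using nn_integral_rotate_aux[of "\<lambda>z. indicator A (v * z)" v]
        nn_integral_rotate_aux[of "indicator A" v] v by simp
    then show ?thesis by (simp add: v2 mult.assoc[symmetric])
  qed
  have "emeasure (distr lborel borel (\<lambda>z. u * z)) A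
      = (\<integral>\<^sup>+z. indicator A z \<partial>distr lborel borel (\<lambda>z. u * z))" by simp
  also have "\<dots> = (\<integral>\<^sup>+z. indicator A (u * z) \<partial>lborel)"
    by (subst nn_integral_distr) auto
  finally show "emeasure (distr lborel borel (\<lambda>z. u * z)) A = emeasure lborel A"
    unfolding inv .
qed simp

lemma integral_lborel_rotate:
  fixes f :: "complex \<Rightarrow> 'a::{banach, second_countable_topology}"
  assumes [measurable]: "f \<in> borel_measurable borel" and u: "cmod u = 1"
  shows "(LINT z|lborel. f (u * z)) = (LINT z|lborel. f z)"
    and "integrable lborel (\<lambda>z. f (u * z)) \<longleftrightarrow> integrable lborel f"
proof -
  show "(LINT z|lborel. f (u * z)) = (LINT z|lborel. f z)"
    using integral_distr[of "\<lambda>z. u * z" lborel borel f] distr_lborel_rotate[OF u] by simp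
  show "integrable lborel (\<lambda>z. f (u * z)) \<longleftrightarrow> integrable lborel f"
    using integrable_distr_eq[of "\<lambda>z. u * z" lborel borel f] distr_lborel_rotate[OF u] by simp
qed

section \<open>Integration of radial functions over the disk\<close>

lemma emeasure_annulus:
  assumes "0 \<le> x"
  shows "emeasure lborel {w::complex. cmod w < 1 \<and> x < (cmod w)\<^sup>2} = ennreal (pi * (1 - x))"
proof (cases "x < 1")
  case True
  have eq: "{w::complex. cmod w < 1 \<and> x < (cmod w)\<^sup>2} = ball 0 1 - cball 0 (sqrt x)"
  proof -
    have "x < (cmod w)\<^sup>2 \<longleftrightarrow> sqrt x < cmod w" for w :: complex
      using real_sqrt_less_iff[of x "(cmod w)\<^sup>2"] by simp
    then show ?thesis
      by (intro set_eqI) (simp only: mem_Collect_eq Diff_iff mem_ball_0 mem_cball_0 not_le)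
  qed
  have "emeasure lborel (ball 0 1 - cball (0::complex) (sqrt x))
    = emeasure lborel (ball (0::complex) 1) - emeasure lborel (cball (0::complex) (sqrt x))"
  proof (rule emeasure_Diff)
    have "sqrt x < 1" using True by simp
    then show "cball (0::complex) (sqrt x) \<subseteq> ball 0 1" by (auto intro: le_less_trans simp del: real_sqrt_lt_1_iff)
  qed (use assms in \<open>auto simp: emeasure_cball\<close>)
  also have "\<dots> = ennreal pi - ennreal (pi * x)"
    using assms by (simp add: emeasure_ball emeasure_cball unit_ball_vol_2)
  also have "\<dots> = ennreal (pi * (1 - x))"
    using assms by (simp add: ennreal_minus algebra_simps)
  finally show ?thesis unfolding eq .
next
  case False
  have "\<not> x < (cmod w)\<^sup>2" if "cmod w < 1" for w :: complex
  proof -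
    have "(cmod w)\<^sup>2 < 1" using that by (simp add: abs_square_less_1)
    then show ?thesis using False by linarith
  qed
  then have "{w::complex. cmod w < 1 \<and> x < (cmod w)\<^sup>2} = {}" by blast
  \<comment> \<open>Here pi (1 - x) is nonpositive and \<open>ennreal\<close> truncates it to 0,
    which matches the empty set.\<close>
  moreover have "ennreal (pi * (1 - x)) = 0"
    using False by (simp add: ennreal_neg mult_nonneg_nonpos)
  ultimately show ?thesis by (simp only: emeasure_empty)
qed

text \<open>This takes the place of polar coordinates: the area where |w|^2 exceeds x is affine in x
  on [0, 1], so |w|^2 has constant density pi there. Half lines suffice for the comparison because
  the measures are finite on them.\<close>

lemma distr_disk_cmod_power2:
  "distr (density lborel (indicator (ball (0::complex) 1))) borel (\<lambda>w. (cmod w)\<^sup>2)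
    = density lborel (\<lambda>t. ennreal pi * indicator {0..1} t)"
proof (rule measure_eqI_lessThan)
  have L: "emeasure (distr (density lborel (indicator (ball (0::complex) 1))) borel
      (\<lambda>w. (cmod w)\<^sup>2)) {x<..} = emeasure lborel {w::complex. cmod w < 1 \<and> x < (cmod w)\<^sup>2}" for x
  proof -
    have "emeasure (distr (density lborel (indicator (ball (0::complex) 1))) borel
      (\<lambda>w. (cmod w)\<^sup>2)) {x<..}
      = emeasure (density lborel (indicator (ball (0::complex) 1))) {w. x < (cmod w)\<^sup>2}"
      by (subst emeasure_distr) (auto intro!: arg_cong2[where f=emeasure])
    also have "\<dots> = (\<integral>\<^sup>+w. indicator (ball 0 1) w * indicator {w::complex. x < (cmod w)\<^sup>2} w \<partial>lborel)"
      by (subst emeasure_density) (auto intro!: borel_measurable_indicator)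
    also have "\<dots> = (\<integral>\<^sup>+w. indicator {w::complex. cmod w < 1 \<and> x < (cmod w)\<^sup>2} w \<partial>lborel)"
      by (intro nn_integral_cong) (auto simp: indicator_def)
    finally show ?thesis by simp
  qed
  have R: "emeasure (density lborel (\<lambda>t. ennreal pi * indicator {0..1} t)) {x<..}
     = ennreal pi * emeasure lborel ({0..1} \<inter> {x<..})" for x :: real
  proof -
    have "emeasure (density lborel (\<lambda>t. ennreal pi * indicator {0..1} t)) {x<..}
      = (\<integral>\<^sup>+t. ennreal pi * indicator ({0..1} \<inter> {x<..}) t \<partial>lborel)"
      by (subst emeasure_density) (auto intro!: nn_integral_cong simp: indicator_def)
    then show ?thesis by (simp add: nn_integral_cmult)
  qed
  show lr: "emeasure (distr (density lborel (indicator (ball (0::complex) 1))) borel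
      (\<lambda>w. (cmod w)\<^sup>2)) {x<..}
    = emeasure (density lborel (\<lambda>t. ennreal pi * indicator {0..1} t)) {x<..}" for x
  proof (cases "0 \<le> x")
    case True
    then have "{0..1} \<inter> {x<..} = {x<..1}" by auto
    then show ?thesis using True unfolding L R emeasure_annulus[OF True]
      by (cases "x \<le> 1") (simp_all add: ennreal_mult ennreal_neg mult_nonneg_nonpos)
  next
    case False
    then have "{0..1} \<inter> {x<..} = {0..1}" by auto
    moreover have "{w::complex. cmod w < 1 \<and> x < (cmod w)\<^sup>2} = ball 0 1"
      using False by (auto intro: less_le_trans[of x 0])
    ultimately show ?thesis unfolding L R
      by (simp add: emeasure_ball unit_ball_vol_2)
  qed
  show "emeasure (distr (density lborel (indicator (ball (0::complex) 1))) borel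
      (\<lambda>w. (cmod w)\<^sup>2)) {x<..} < \<infinity>" for x
  proof -
    have "emeasure lborel ({0..1} \<inter> {x<..}) \<le> emeasure lborel {0..1::real}"
      by (intro emeasure_mono) auto
    then have "emeasure lborel ({0..1} \<inter> {x<..}) < top" by (rule le_less_trans) simp
    then show ?thesis unfolding lr R by (simp add: ennreal_mult_less_top)
  qed
qed simp_all

lemma integral_disk_radial:
  fixes h :: "real \<Rightarrow> complex"
  assumes [measurable]: "h \<in> borel_measurable borel"
  shows "(LINT w:ball (0::complex) 1|lborel. h ((cmod w)\<^sup>2)) = of_real pi * (LINT t:{0..1}|lborel. h t)"
proof -
  have "(LINT w:ball (0::complex) 1|lborel. h ((cmod w)\<^sup>2))
    = integral\<^sup>L (density lborel (\<lambda>w. ennreal (indicator (ball (0::complex) 1) w))) (\<lambda>w. h ((cmod w)\<^sup>2))"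
    unfolding set_lebesgue_integral_def
    by (subst integral_density) (auto intro!: borel_measurable_indicator)
  also have "\<dots> = integral\<^sup>L (distr (density lborel (indicator (ball (0::complex) 1))) borel (\<lambda>w. (cmod w)\<^sup>2)) h"
    by (subst integral_distr) (auto simp: ennreal_indicator)
  also have "\<dots> = integral\<^sup>L (density lborel (\<lambda>t. ennreal (pi * indicator {0..1} t))) h"
    unfolding distr_disk_cmod_power2 by (simp add: ennreal_mult ennreal_indicator)
  also have "\<dots> = (LINT t|lborel. (pi * indicator {0..1} t) *\<^sub>R h t)"
    by (subst integral_density) auto
  also have "\<dots> = of_real pi * (LINT t:{0..1}|lborel. h t)"
  proof -
    have "(pi * indicator {0..1} t) *\<^sub>R h t = of_real pi * (indicator {0..1} t *\<^sub>R h t)" for t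
      by (simp add: scaleR_conv_of_real)
    then show ?thesis unfolding set_lebesgue_integral_def by (simp only: integral_mult_right_zero)
  qed
  finally show ?thesis .
qed


section \<open>Circle averages by Cauchy's formula\<close>

text \<open>On the circle u = r cis theta one has cnj u = r^2/u, so 1 - z cnj u = (u - p)/u with p =
  z r^2. The integral becomes a contour integral of u f(u)/(u - p)^2, up to the factor 1/i, and
  Cauchy's formula evaluates it by the derivative of u f(u) at p.\<close>

lemma circle_average_aux:
  fixes f :: "complex \<Rightarrow> complex"
  assumes f: "f holomorphic_on ball 0 1" and z: "cmod z < 1" and r: "0 < r" "r < 1"
  shows "((\<lambda>\<theta>. f (of_real r * cis \<theta>) / (1 - z * cnj (of_real r * cis \<theta>))\<^sup>2) has_integral
    2 * pi * (f (z * (of_real r)\<^sup>2) + z * (of_real r)\<^sup>2 * deriv f (z * (of_real r)\<^sup>2))) {0..2 * pi}"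
proof -
  define p where "p = z * (of_real r)\<^sup>2"
  have "cmod p < r"
  proof -
    have "cmod p = cmod z * r * r" using r by (simp add: p_def norm_mult norm_power power2_eq_square)
    also have "\<dots> < 1 * r"
      using z r mult_strict_mono'[of "cmod z" 1 r 1] by (intro mult_strict_right_mono) auto
    finally show ?thesis by simp
  qed
  then have p: "p \<in> ball 0 r" "p \<in> ball 0 1" using r by auto
  have sub: "cball 0 r \<subseteq> ball (0::complex) 1" using r by auto
  have F: "(\<lambda>\<zeta>. \<zeta> * f \<zeta>) holomorphic_on ball 0 1" by (intro holomorphic_intros f)
  have F': "deriv (\<lambda>\<zeta>. \<zeta> * f \<zeta>) p = f p + p * deriv f p"
  proof (rule DERIV_imp_deriv)
    have "(f has_field_derivative deriv f p) (at p)"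
      using f p holomorphic_derivI by blast
    then show "((\<lambda>\<zeta>. \<zeta> * f \<zeta>) has_field_derivative f p + p * deriv f p) (at p)"
      by (auto intro!: derivative_eq_intros)
  qed
  have "((\<lambda>u. u * f u / (u - p) ^ Suc 1) has_contour_integral
      ((2 * pi * \<i>) / (fact 1) * (deriv ^^ 1) (\<lambda>\<zeta>. \<zeta> * f \<zeta>) p)) (circlepath 0 r)"
    using p(1) ball_subset_cball sub
    by (intro Cauchy_has_contour_integral_higher_derivative_circlepath
        holomorphic_on_imp_continuous_on holomorphic_on_subset[OF F]) blast+
  then have "((\<lambda>t. of_real r * cis t * f (of_real r * cis t) / (of_real r * cis t - p)\<^sup>2 * r * \<i> * cis t)
      has_integral 2 * pi * \<i> * (f p + p * deriv f p)) {0..2 * pi}"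
    unfolding circlepath_def by (subst (asm) has_contour_integral_part_circlepath_iff)
      (simp_all add: F' numeral_2_eq_2)
  then have "((\<lambda>t. (1 / \<i>) * (of_real r * cis t * f (of_real r * cis t) / (of_real r * cis t - p)\<^sup>2 * r * \<i> * cis t))
      has_integral (1 / \<i>) * (2 * pi * \<i> * (f p + p * deriv f p))) {0..2 * pi}"
    by (rule has_integral_mult_right)
  moreover have "(1 / \<i>) * (of_real r * cis t * f (of_real r * cis t) / (of_real r * cis t - p)\<^sup>2 * r * \<i> * cis t)
      = f (of_real r * cis t) / (1 - z * cnj (of_real r * cis t))\<^sup>2" for t
  proof -
    define u where "u = of_real r * cis t"
    have u: "u \<noteq> 0" using r by (simp add: u_def)
    have "u * cnj u = (of_real r)\<^sup>2" unfolding u_def complex_norm_square[symmetric]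
      using r by (simp add: norm_mult)
    then have "u - p = u * (1 - z * cnj u)" unfolding p_def by (simp add: algebra_simps)
    then have "(u * f u / (u - p)\<^sup>2) * u = f u / (1 - z * cnj u)\<^sup>2"
      using u by (simp add: power2_eq_square)
    then show ?thesis unfolding u_def by (simp add: mult_ac)
  qed
  moreover have "(1 / \<i>) * (c * \<i> * X) = c * X" for c X by (simp add: field_simps del: divide_i)
  ultimately show ?thesis unfolding p_def by (simp only:)
qed

text \<open>A rotation reduces this to the circle of radius r = |w|: with v = \<open>sgn w\<close>,
  apply the previous lemma to f(v u) as a function of u and to z cnj v in place of z. For w = 0 the
  circle degenerates and the integrand is constant.\<close>

lemma circle_average:
  fixes f :: "complex \<Rightarrow> complex" and p :: complex
  assumes f: "f holomorphic_on ball 0 1" and z: "cmod z < 1" and w: "cmod w < 1"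
  defines "p \<equiv> z * of_real ((cmod w)\<^sup>2)"
  shows "((\<lambda>\<theta>. f (cis \<theta> * w) / (1 - z * cnj (cis \<theta> * w))\<^sup>2) has_integral
    2 * pi * (f p + p * deriv f p)) {0..2 * pi}"
proof (cases "w = 0")
  case True
  have "((\<lambda>\<theta>. f 0) has_integral (2 * pi - 0) *\<^sub>R f 0) {0..2 * pi}"
    using has_integral_const_real[of "f 0" 0 "2 * pi"] by simp
  then show ?thesis using True by (simp add: p_def scaleR_conv_of_real)
next
  case False
  define r where "r = cmod w"
  define v where "v = sgn w"
  have v: "cmod v = 1" using False by (simp add: v_def norm_sgn)
  then have v': "v * cnj v = 1" by (simp flip: complex_norm_square)
  have w_eq: "w = of_real r * v" using False by (simp add: v_def r_def sgn_eq)
  have maps: "(\<lambda>\<zeta>. v * \<zeta>) ` ball 0 1 \<subseteq> ball 0 1" using v by (auto simp: norm_mult)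
  have fv: "(\<lambda>\<zeta>. f (v * \<zeta>)) holomorphic_on ball 0 1"
    using holomorphic_on_compose_gen[OF _ f maps] by (simp add: o_def holomorphic_intros)
  have p_eq: "v * (z * cnj v * (of_real r)\<^sup>2) = p"
  proof -
    have "v * (z * cnj v * (of_real r)\<^sup>2) = (v * cnj v) * (z * (of_real r)\<^sup>2)" by (simp add: mult_ac)
    then show ?thesis by (simp add: v' p_def r_def)
  qed
  have "p \<in> ball 0 1"
  proof -
    have "cmod p = cmod z * r\<^sup>2" by (simp add: p_def r_def norm_mult norm_power)
    moreover have "r\<^sup>2 \<le> 1" using w by (simp add: r_def power_le_one)
    ultimately have "cmod p \<le> cmod z" using mult_left_mono[of "r\<^sup>2" 1 "cmod z"] by simp
    then show ?thesis using z by simp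
  qed
  then have "(f has_field_derivative deriv f p) (at (v * (z * cnj v * (of_real r)\<^sup>2)))"
    unfolding p_eq using f holomorphic_derivI by blast
  then have "((\<lambda>\<zeta>. f (v * \<zeta>)) has_field_derivative deriv f p * v) (at (z * cnj v * (of_real r)\<^sup>2))"
    by (rule DERIV_chain2) (auto intro!: derivative_eq_intros)
  then have d: "deriv (\<lambda>\<zeta>. f (v * \<zeta>)) (z * cnj v * (of_real r)\<^sup>2) = deriv f p * v"
    by (rule DERIV_imp_deriv)
  have zv: "cmod (z * cnj v) < 1" using z v by (simp add: norm_mult)
  have r: "0 < r" "r < 1" using False w by (auto simp: r_def)
  have int: "f (v * (of_real r * cis \<theta>)) / (1 - z * cnj v * cnj (of_real r * cis \<theta>))\<^sup>2
     = f (cis \<theta> * w) / (1 - z * cnj (cis \<theta> * w))\<^sup>2" for \<theta>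
    by (simp add: w_eq mult_ac)
  have val: "z * cnj v * (of_real r)\<^sup>2 * (deriv f p * v) = p * deriv f p"
    unfolding p_eq[symmetric] by (simp add: mult_ac)
  show ?thesis
    using circle_average_aux[OF fv zv r] unfolding d p_eq val int .
qed

section \<open>The reproducing integral\<close>

text \<open>The kernel factor is at most 1/(1 - |z|)^2, and |f| <= 1 + |f|^2 is integrable because
  the disk has finite area. This supplies the integrability for Fubini's theorem below.\<close>

lemma bergman_integrable_kernel:
  assumes f: "f \<in> bergman_space" and z: "cmod z < 1"
  shows "set_integrable lborel (ball 0 1) (\<lambda>w. f w / (1 - z * cnj w)\<^sup>2)"
proof -
  have hol: "f holomorphic_on ball 0 1"
    and int: "set_integrable lborel (ball 0 1) (\<lambda>w. (cmod (f w))\<^sup>2)"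
    using f by (auto simp: bergman_space_def)
  have nz: "1 - cmod z \<le> cmod (1 - z * cnj w)" if "w \<in> ball 0 1" for w
  proof -
    have "cmod (z * cnj w) \<le> cmod z"
      using that mult_left_mono[of "cmod w" 1 "cmod z"] by (simp add: norm_mult)
    then show ?thesis using norm_triangle_ineq2[of 1 "z * cnj w"] by simp
  qed
  have cont: "continuous_on (ball 0 1) (\<lambda>w. f w / (1 - z * cnj w)\<^sup>2)"
    using nz z hol by (intro continuous_intros holomorphic_on_imp_continuous_on) force+
  have "set_integrable lborel (ball (0::complex) 1) (\<lambda>w. 1::real)"
    unfolding set_integrable_def by (auto simp: emeasure_ball)
  then have "set_integrable lborel (ball 0 1) (\<lambda>w. (1 / (1 - cmod z)\<^sup>2) * (1 + (cmod (f w))\<^sup>2))"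
    using int by (intro set_integrable_mult_right set_integral_add) auto
  then show ?thesis
  proof (rule set_integrable_bound)
    show "set_borel_measurable lborel (ball 0 1) (\<lambda>w. f w / (1 - z * cnj w)\<^sup>2)"
      unfolding set_borel_measurable_def using borel_measurable_continuous_on_indicator[OF _ cont] by simp
    have "norm (f w / (1 - z * cnj w)\<^sup>2) \<le> norm ((1 / (1 - cmod z)\<^sup>2) * (1 + (cmod (f w))\<^sup>2))"
      if w: "w \<in> ball 0 1" for w
    proof -
      have "(1 - cmod z)\<^sup>2 \<le> (cmod (1 - z * cnj w))\<^sup>2" using nz[OF w] z by (intro power_mono) auto
      moreover have "cmod (f w) \<le> 1 + (cmod (f w))\<^sup>2"
        using zero_le_power2[of "cmod (f w) - 1"] by (simp add: power2_eq_square algebra_simps)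
          (smt (verit) norm_ge_zero)
      ultimately have "cmod (f w) / (cmod (1 - z * cnj w))\<^sup>2 \<le> (1 + (cmod (f w))\<^sup>2) / (1 - cmod z)\<^sup>2"
        using z by (intro frac_le) auto
      then show ?thesis by (simp add: norm_divide norm_power abs_of_nonneg)
    qed
    then show "AE w in lborel. w \<in> ball 0 1 \<longrightarrow>
        norm (f w / (1 - z * cnj w)\<^sup>2) \<le> norm ((1 / (1 - cmod z)\<^sup>2) * (1 + (cmod (f w))\<^sup>2))"
      by auto
  qed
qed

lemma bergman_reproducing_integral:
  assumes f: "f \<in> bergman_space" and z: "cmod z < 1"
  shows "(LINT w:ball 0 1|lborel. f w / (1 - z * cnj w)\<^sup>2) = of_real pi * f z"
proof -
  have hol: "f holomorphic_on ball 0 1" using f by (simp add: bergman_space_def)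
  define g where "g = (\<lambda>w. f w / (1 - z * cnj w)\<^sup>2)"
  define G where "G = (\<lambda>w. indicator (ball 0 1) w *\<^sub>R g w)"
  \<comment> \<open>By the product rule \<open>h\<close> is the derivative of t f(z t), and by
    \<open>circle_average\<close> its value at |w|^2 is the mean of \<open>g\<close> over the circle
    through w.\<close>
  define h where "h = (\<lambda>t::real. f (z * of_real t) + z * of_real t * deriv f (z * of_real t))"
  define H where "H = (\<lambda>t. indicator {0..1} t *\<^sub>R h t)"
  \<comment> \<open>\<open>\<Phi>\<close> is integrated in both orders: over w first, rotation
    invariance gives 2 pi times the integral of \<open>G\<close>; over theta first, the circle
    average leaves a radial function.\<close>
  define \<Phi> where "\<Phi> = (\<lambda>\<theta> w. indicator {0..2 * pi} \<theta> *\<^sub>R G (cis \<theta> * w))"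
  have G: "integrable lborel G"
    using bergman_integrable_kernel[OF f z] by (simp add: set_integrable_def G_def g_def)
  then have [measurable]: "G \<in> borel_measurable borel" by (auto dest: borel_measurable_integrable)
  have [measurable]: "cis \<in> borel_measurable borel"
    by (intro borel_measurable_continuous_onI continuous_intros)
  have zt: "z * of_real t \<in> ball 0 1" if "t \<in> {0..1}" for t
    using that z mult_left_mono[of t 1 "cmod z"] by (simp add: norm_mult)
  have hcont: "continuous_on {0..1} h"
  proof -
    have "continuous_on {0..1} (\<lambda>t. f (z * of_real t))"
      using zt by (intro continuous_on_compose2[OF holomorphic_on_imp_continuous_on[OF hol]] continuous_intros) auto
    moreover have "continuous_on {0..1} (\<lambda>t. deriv f (z * of_real t))"
      using zt by (intro continuous_on_compose2[OF holomorphic_on_imp_continuous_on[OF holomorphic_deriv[OF hol]]]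
        continuous_intros) auto
    ultimately show ?thesis unfolding h_def by (intro continuous_intros)
  qed
  have [measurable]: "H \<in> borel_measurable borel"
    unfolding H_def by (rule borel_measurable_continuous_on_indicator[OF _ hcont]) simp
  have rot: "integrable lborel (\<lambda>w. G (cis \<theta> * w))" "(LINT w|lborel. G (cis \<theta> * w)) = (LINT w|lborel. G w)"
    "(LINT w|lborel. norm (G (cis \<theta> * w))) = (LINT w|lborel. norm (G w))" for \<theta>
    using integral_lborel_rotate[of G "cis \<theta>"] integral_lborel_rotate(1)[of "\<lambda>w. norm (G w)" "cis \<theta>"] G
    by auto
  have "integrable (lborel \<Otimes>\<^sub>M lborel) (case_prod \<Phi>)"
  proof (rule lborel_pair.Fubini_integrable)
    show "case_prod \<Phi> \<in> borel_measurable (lborel \<Otimes>\<^sub>M lborel)" unfolding \<Phi>_def by measurable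
    show "integrable lborel (\<lambda>\<theta>. LINT w|lborel. norm (case_prod \<Phi> (\<theta>, w)))"
      unfolding \<Phi>_def by (simp add: rot)
    show "AE \<theta> in lborel. integrable lborel (\<lambda>w. case_prod \<Phi> (\<theta>, w))"
      unfolding \<Phi>_def using rot by (intro AE_I2) simp
  qed
  then have "(LINT w|lborel. LINT \<theta>|lborel. \<Phi> \<theta> w) = (LINT \<theta>|lborel. LINT w|lborel. \<Phi> \<theta> w)"
    by (rule lborel_pair.Fubini_integral)
  also have "\<dots> = of_real (2 * pi) * (LINT w|lborel. G w)"
    unfolding \<Phi>_def by (simp add: rot scaleR_conv_of_real)
  finally have fubini: "(LINT w|lborel. LINT \<theta>|lborel. \<Phi> \<theta> w) = of_real (2 * pi) * (LINT w|lborel. G w)" .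
  have "(LINT \<theta>|lborel. \<Phi> \<theta> w) = indicator (ball 0 1) w *\<^sub>R (of_real (2 * pi) * H ((cmod w)\<^sup>2))" for w
  proof (cases "w \<in> ball 0 1")
    case False
    then show ?thesis by (simp add: \<Phi>_def G_def norm_mult)
  next
    case True
    then have w: "cmod w < 1" by simp
    have "set_integrable lborel {0..2 * pi} (\<lambda>\<theta>. g (cis \<theta> * w))"
    proof (rule borel_integrable_atLeastAtMost')
      have "1 - z * cnj (cis \<theta> * w) \<noteq> 0" for \<theta>
      proof
        assume "1 - z * cnj (cis \<theta> * w) = 0"
        then have "cmod (z * cnj (cis \<theta> * w)) = 1" by simp
        moreover have "cmod z * cmod w < 1 * 1" using w z by (intro mult_strict_mono') auto
        ultimately show False by (simp add: norm_mult)
      qed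
      then show "continuous_on {0..2 * pi} (\<lambda>\<theta>. g (cis \<theta> * w))"
        unfolding g_def using w
        by (intro continuous_intros continuous_on_compose2[OF holomorphic_on_imp_continuous_on[OF hol]])
          (auto simp: norm_mult)
    qed
    then have "(LINT \<theta>:{0..2 * pi}|lborel. g (cis \<theta> * w)) = integral {0..2 * pi} (\<lambda>\<theta>. g (cis \<theta> * w))"
      by (rule set_borel_integral_eq_integral(2))
    also have "\<dots> = 2 * pi * h ((cmod w)\<^sup>2)"
      using integral_unique[OF circle_average[OF hol z w]] by (simp add: g_def h_def)
    finally have "(LINT \<theta>:{0..2 * pi}|lborel. g (cis \<theta> * w)) = 2 * pi * h ((cmod w)\<^sup>2)" .
    then show ?thesis
      using w by (simp add: \<Phi>_def G_def H_def set_lebesgue_integral_def norm_mult power_le_one)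
  qed
  then have "(LINT w|lborel. LINT \<theta>|lborel. \<Phi> \<theta> w)
     = (LINT w:ball (0::complex) 1|lborel. of_real (2 * pi) * H ((cmod w)\<^sup>2))"
    by (simp only: set_lebesgue_integral_def)
  also have "\<dots> = of_real (2 * pi) * (LINT w:ball (0::complex) 1|lborel. H ((cmod w)\<^sup>2))"
    by (rule set_integral_mult_right)
  also have "\<dots> = of_real (2 * pi) * (of_real pi * (LINT t:{0..1}|lborel. H t))"
    by (subst integral_disk_radial) simp_all
  also have "(LINT t:{0..1}|lborel. H t) = f z"
  proof -
    have "(LINT t:{0..1}|lborel. H t) = (LINT t|lborel. indicator {0..1} t *\<^sub>R h t)"
      unfolding set_lebesgue_integral_def H_def by (intro Bochner_Integration.integral_cong) (auto simp: indicator_def)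
    also have "\<dots> = of_real 1 * f (z * of_real 1) - of_real 0 * f (z * of_real 0)"
    proof (rule integral_FTC_atLeastAtMost[where F="\<lambda>t. of_real t * f (z * of_real t)"])
      fix t :: real assume t: "0 \<le> t" "t \<le> 1"
      have "(f has_field_derivative deriv f (z * of_real t)) (at (z * of_real t))"
        using zt[of t] t holomorphic_derivI[OF hol] by auto
      then have "((\<lambda>\<zeta>. f (z * \<zeta>)) has_field_derivative deriv f (z * of_real t) * z) (at (of_real t))"
        by (rule DERIV_chain2) (auto intro!: derivative_eq_intros)
      then have "((\<lambda>\<zeta>. \<zeta> * f (z * \<zeta>)) has_field_derivative h t) (at (of_real t))"
        by (auto intro!: derivative_eq_intros simp: h_def)
      then have "((\<lambda>t. of_real t * f (z * of_real t)) has_vector_derivative h t) (at t)"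
        by (rule has_vector_derivative_real_field)
      then show "((\<lambda>t. of_real t * f (z * of_real t)) has_vector_derivative h t) (at t within {0..1})"
        by (rule has_vector_derivative_at_within)
    qed (use hcont in auto)
    finally show ?thesis by simp
  qed
  finally have "of_real (2 * pi) * (LINT w|lborel. G w) = of_real (2 * pi) * (of_real pi * f z)"
    unfolding fubini .
  then show ?thesis by (simp add: G_def g_def set_lebesgue_integral_def)
qed

section \<open>Identification of the Bergman kernel\<close>

text \<open>The value 0 off the disk matches the convention in \<open>bergman_space\<close>, so that
  equality with \<open>bergman_kernel z\<close> can hold on the whole plane.\<close>

definition disk_kernel :: "complex \<Rightarrow> complex \<Rightarrow> complex" where
  "disk_kernel z w = (if w \<in> ball 0 1 then 1 / (of_real pi * (1 - cnj z * w)\<^sup>2) else 0)"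

lemma one_minus_cnj_mult_ge:
  assumes "cmod w \<le> 1"
  shows "1 - cmod z \<le> cmod (1 - cnj z * w)"
proof -
  have "cmod (cnj z * w) \<le> cmod z"
    using assms mult_left_mono[of "cmod w" 1 "cmod z"] by (simp add: norm_mult)
  then show ?thesis using norm_triangle_ineq2[of 1 "cnj z * w"] by simp
qed

lemma bounded_holomorphic_in_bergman_space:
  assumes hol: "f holomorphic_on ball 0 1" and bound: "\<And>w. cmod w < 1 \<Longrightarrow> cmod (f w) \<le> B"
    and zero: "\<And>w. w \<notin> ball 0 1 \<Longrightarrow> f w = 0"
  shows "f \<in> bergman_space"
proof -
  have "set_integrable lborel (ball (0::complex) 1) (\<lambda>w. B\<^sup>2)"
    unfolding set_integrable_def by (auto simp: emeasure_ball)
  then have "set_integrable lborel (ball 0 1) (\<lambda>w. (cmod (f w))\<^sup>2)"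
  proof (rule set_integrable_bound)
    have cont: "continuous_on (ball 0 1) (\<lambda>w. (cmod (f w))\<^sup>2)"
      by (intro continuous_intros holomorphic_on_imp_continuous_on hol)
    show "set_borel_measurable lborel (ball 0 1) (\<lambda>w. (cmod (f w))\<^sup>2)"
      unfolding set_borel_measurable_def
      using borel_measurable_continuous_on_indicator[OF _ cont] by simp
    show "AE w in lborel. w \<in> ball 0 1 \<longrightarrow> norm ((cmod (f w))\<^sup>2) \<le> norm (B\<^sup>2)"
      using bound by (intro AE_I2) (auto intro: power_mono)
  qed
  then show ?thesis using hol zero by (simp add: bergman_space_def)
qed

text \<open>Since |phi| < 1 on the disk, the composition is bounded by 1/(pi (1 - |z|)^2). The
  reproducing property thus applies to the image of the kernel under the composition operator; phi =
  id gives the kernel itself.\<close>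

lemma disk_kernel_comp_in_bergman_space:
  assumes z: "cmod z < 1" and \<phi>: "\<phi> holomorphic_on ball 0 1" "\<phi> ` ball 0 1 \<subseteq> ball 0 1"
  shows "(\<lambda>w. if w \<in> ball 0 1 then disk_kernel z (\<phi> w) else 0) \<in> bergman_space"
proof (rule bounded_holomorphic_in_bergman_space)
  have ge: "1 - cmod z \<le> cmod (1 - cnj z * \<phi> w)" if "cmod w < 1" for w
    using that \<phi>(2) by (intro one_minus_cnj_mult_ge) (force simp: image_subset_iff)
  have "(\<lambda>w. 1 / (of_real pi * (1 - cnj z * \<phi> w)\<^sup>2)) holomorphic_on ball 0 1"
    using ge z by (intro holomorphic_intros \<phi>(1)) force
  then show "(\<lambda>w. if w \<in> ball 0 1 then disk_kernel z (\<phi> w) else 0) holomorphic_on ball 0 1"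
    by (rule holomorphic_transform) (use \<phi>(2) in \<open>auto simp: disk_kernel_def image_subset_iff\<close>)
  show "cmod (if w \<in> ball 0 1 then disk_kernel z (\<phi> w) else 0) \<le> 1 / (pi * (1 - cmod z)\<^sup>2)"
    if w: "cmod w < 1" for w
  proof -
    have "(1 - cmod z)\<^sup>2 \<le> (cmod (1 - cnj z * \<phi> w))\<^sup>2" using ge[OF w] z by (intro power_mono) auto
    moreover have "\<phi> w \<in> ball 0 1" using \<phi>(2) w by (auto simp: image_subset_iff)
    ultimately show ?thesis using w z
      by (auto simp: disk_kernel_def norm_divide norm_mult norm_power intro!: frac_le mult_left_mono)
  qed
qed simp

lemma disk_kernel_in_bergman_space:
  assumes "cmod z < 1"
  shows "disk_kernel z \<in> bergman_space"
proof -
  have "(\<lambda>w. if w \<in> ball 0 1 then disk_kernel z w else 0) = disk_kernel z"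
    by (auto simp: disk_kernel_def)
  then show ?thesis
    using disk_kernel_comp_in_bergman_space[OF assms, of "\<lambda>w. w"] by (simp add: holomorphic_intros)
qed

lemma bergman_inner_disk_kernel:
  assumes f: "f \<in> bergman_space" and z: "cmod z < 1"
  shows "bergman_inner f (disk_kernel z) = f z"
proof -
  have "bergman_inner f (disk_kernel z)
    = (LINT w:ball 0 1|lborel. (1 / of_real pi) * (f w / (1 - z * cnj w)\<^sup>2))"
    unfolding bergman_inner_def by (rule set_lebesgue_integral_cong) (auto simp: disk_kernel_def)
  then show ?thesis
    by (simp only: set_integral_mult_right bergman_reproducing_integral[OF f z]) simp
qed

lemma bergman_inner_commute: "bergman_inner g f = cnj (bergman_inner f g)"
  unfolding bergman_inner_def set_lebesgue_integral_def
  by (subst Bochner_Integration.integral_cnj[symmetric]) (simp add: mult.commute)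

lemma bergman_kernel_eq:
  assumes z: "cmod z < 1"
  shows "bergman_kernel z = disk_kernel z"
  unfolding bergman_kernel_def
proof (rule the_equality)
  show "disk_kernel z \<in> bergman_space \<and> (\<forall>f\<in>bergman_space. f z = bergman_inner f (disk_kernel z))"
    using disk_kernel_in_bergman_space[OF z] bergman_inner_disk_kernel[OF _ z] by simp
next
  fix K assume K: "K \<in> bergman_space \<and> (\<forall>f\<in>bergman_space. f z = bergman_inner f K)"
  show "K = disk_kernel z"
  proof
    fix w
    show "K w = disk_kernel z w"
    proof (cases "w \<in> ball 0 1")
      case True
      then have w: "cmod w < 1" by simp
      \<comment> \<open>Uniqueness by symmetry: the explicit kernel at w reproduces K w, and the
        assumed property of K evaluates the same inner product, conjugated, at z.\<close>
      have "K w = cnj (bergman_inner (disk_kernel w) K)"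
        using K bergman_inner_disk_kernel[OF _ w] bergman_inner_commute by metis
      also have "\<dots> = cnj (disk_kernel w z)" using K disk_kernel_in_bergman_space[OF w] by simp
      finally show ?thesis using z w by (simp add: disk_kernel_def mult.commute)
    qed (use K in \<open>simp add: bergman_space_def disk_kernel_def\<close>)
  qed
qed

section \<open>The Berezin transform of a composition operator\<close>

text \<open>By the reproducing property the transform is K_z(phi(z)) divided by the squared norm of
  K_z, which is K_z(z) = 1/(pi (1 - |z|^2)^2).\<close>

lemma berezin_transform_composition_operator:
  assumes z: "cmod z < 1" and \<phi>: "\<phi> holomorphic_on ball 0 1" "\<phi> ` ball 0 1 \<subseteq> ball 0 1"
  shows "berezin_transform (composition_operator \<phi>) z
    = (of_real (1 - (cmod z)\<^sup>2) / (1 - cnj z * \<phi> z))\<^sup>2"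
proof -
  define N where "N = bergman_norm (disk_kernel z)"
  define F where "F = (\<lambda>w. if w \<in> ball 0 1 then disk_kernel z (\<phi> w) else 0)"
  have zz: "1 - cnj z * z = of_real (1 - (cmod z)\<^sup>2)"
    using complex_norm_square[of z] by (simp add: mult.commute)
  have pos: "0 < 1 - (cmod z)\<^sup>2" using z by (simp add: abs_square_less_1)
  have "bergman_inner (disk_kernel z) (disk_kernel z) = of_real (1 / (pi * (1 - (cmod z)\<^sup>2)\<^sup>2))"
    using z bergman_inner_disk_kernel[OF disk_kernel_in_bergman_space[OF z] z]
    unfolding disk_kernel_def[of z z] zz by simp
  then have "N\<^sup>2 = 1 / (pi * (1 - (cmod z)\<^sup>2)\<^sup>2)"
    unfolding N_def bergman_norm_def by (simp only: Re_complex_of_real) simp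
  then have N2: "of_real N * of_real N = (1 / (of_real pi * (of_real (1 - (cmod z)\<^sup>2))\<^sup>2) :: complex)"
    unfolding of_real_mult[symmetric] power2_eq_square by simp
  have "berezin_transform (composition_operator \<phi>) z
     = (LINT w:ball 0 1|lborel. (1 / (of_real N * of_real N)) * (F w * cnj (disk_kernel z w)))"
    unfolding berezin_transform_def bergman_inner_def normalized_bergman_kernel_def
      bergman_kernel_eq[OF z] N_def[symmetric]
    by (rule set_lebesgue_integral_cong) (auto simp: composition_operator_def F_def)
  also have "\<dots> = bergman_inner F (disk_kernel z) / (of_real N * of_real N)"
    unfolding bergman_inner_def by simp
  also have "bergman_inner F (disk_kernel z) = F z"
    using disk_kernel_comp_in_bergman_space[OF z \<phi>] unfolding F_def[symmetric]
    by (rule bergman_inner_disk_kernel[OF _ z])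
  also have "F z = 1 / (of_real pi * (1 - cnj z * \<phi> z)\<^sup>2)"
    using z \<phi>(2) by (auto simp: F_def disk_kernel_def image_subset_iff)
  also have "\<dots> / (of_real N * of_real N) = (of_real (1 - (cmod z)\<^sup>2) / (1 - cnj z * \<phi> z))\<^sup>2"
    unfolding N2 by (simp add: power_divide)
  finally show ?thesis .
qed

text \<open>The sign affects neither holomorphy nor modulus, so both properties of the Moebius maps
  carry over.\<close>

lemma disk_automorphism_eq: "disk_automorphism a z = - Moebius_function 0 a z"
  by (simp add: disk_automorphism_def Moebius_function_simple minus_divide_left)

lemma berezin_transform_disk_automorphism:
  assumes a: "cmod a < 1" and z: "cmod z < 1"
  shows "berezin_transform (composition_operator (disk_automorphism a)) z = (berezin_symbol a z)\<^sup>2"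
proof -
  have "disk_automorphism a holomorphic_on ball 0 1"
    unfolding disk_automorphism_eq[abs_def] by (intro holomorphic_intros Moebius_function_holomorphic a)
  moreover have "disk_automorphism a ` ball 0 1 \<subseteq> ball 0 1"
    using Moebius_function_norm_lt_1[OF a] by (auto simp: disk_automorphism_eq)
  moreover have "of_real (1 - (cmod z)\<^sup>2) / (1 - cnj z * disk_automorphism a z) = berezin_symbol a z"
  proof -
    define d where "d = 1 - cnj a * z"
    \<comment> \<open>Clearing the denominator \<open>d\<close> of the automorphism phi gives 1 -
      cnj z phi(z) = e/d, where e is real because its two cross terms are conjugate.\<close>
    define e where "e = complex_of_real (1 + (cmod z)\<^sup>2 - 2 * Re (cnj a * z))"
    have "cmod (cnj a * z) \<noteq> 1" using norm_mult_disk(1)[OF a z] by simp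
    then have d: "d \<noteq> 0" unfolding d_def by auto
    have e0: "1 + (cmod z)\<^sup>2 - 2 * Re (cnj a * z) \<noteq> 0" using norm_mult_disk(2)[OF a z] by linarith
    then have e: "e \<noteq> 0" unfolding e_def of_real_eq_0_iff .
    have "e = 1 + z * cnj z - (cnj a * z + cnj (cnj a * z))"
      unfolding e_def of_real_diff of_real_add complex_norm_square complex_add_cnj by simp
    then have "1 - cnj z * disk_automorphism a z = e / d"
      using d unfolding disk_automorphism_def d_def[symmetric]
      by (simp add: divide_simps) (simp add: d_def algebra_simps)
    then have "of_real (1 - (cmod z)\<^sup>2) / (1 - cnj z * disk_automorphism a z)
      = of_real (1 - (cmod z)\<^sup>2) / e * d" using d e by simp
    also have "\<dots> = berezin_symbol a z" unfolding berezin_symbol_def e_def d_def of_real_divide ..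
    finally show ?thesis .
  qed
  ultimately show ?thesis by (simp only: berezin_transform_composition_operator[OF z])
qed

theorem theorem1:
  fixes a :: complex
  assumes "a \<in> unit_disk"
  shows "convex (berezin_range (composition_operator (disk_automorphism a)))
     \<longleftrightarrow> 0 \<le> cmod a \<and> cmod a \<le> sqrt 2 / 2"
proof -
  have a: "cmod a < 1" using assms by simp
  have "berezin_range (composition_operator (disk_automorphism a))
    = (\<lambda>z. (berezin_symbol a z)\<^sup>2) ` ball 0 1"
    unfolding berezin_range_def
    by (intro image_cong) (simp_all add: berezin_transform_disk_automorphism[OF a])
  then show ?thesis using convex_berezin_symbol_image_iff[OF a] by simp
qed

end
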